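(* Let $K,L$ be convex bodies in $\mathbb{R}^n$, let $\nu\in\mathbb{S}^{n-1}$, and let $h_{\nu,K}$ and $h_{\nu,L}$ denote the slicing support functions of $K$ and $L$, respectively, along the direction $\nu$. If $$h_{\nu,K}(u,p)\le h_{\nu,L}(u,p)\qquad\text{for all }u\in\nu^\perp\text{ and all }p\in\mathbb{R},$$ then $h_K(v)\le h_L(v)$ for all $v\in\mathbb{R}^n$, and consequently $K\subset L$.
   Context: For a convex body $K\subset\mathbb{R}^n$, the support function is $h_K(v)=\sup_{x\in K}x\cdot v$, $v\in\mathbb{R}^n$. For a unit vector $\nu\in\mathbb{S}^{n-1}$ write $\nu^\perp=\{x\in\mathbb{R}^n: x\cdot\nu=0\}$. The slicing support function of $K$ along $\nu$ is $h_{\nu,K}(u,p)=\sup\{x\cdot u: x\in K,\ x\cdot\nu=p\}$ for $u\in\nu^\perp$, $p\in\mathbb{R}$, with value $-\infty$ if $\{x\in K: x\cdot\nu=p\}$ is empty; similarly for $L$. *)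

theory Defs
  imports "HOL-Analysis.Analysis"
begin

(* Convex bodies are not required to have nonempty interior. *)
definition convex_body :: "(real ^ 'n) set \<Rightarrow> bool" where
  "convex_body K \<longleftrightarrow> convex K \<and> compact K \<and> K \<noteq> {}"

(* The supremum is taken in the reals, so it is meaningful only for nonempty bounded K. *)
definition support_fun :: "(real ^ 'n) set \<Rightarrow> real ^ 'n \<Rightarrow> real" where
  "support_fun K v = (SUP x\<in>K. x \<bullet> v)"

(* The supremum is taken in the extended reals, so an empty slice gives Sup {} = -\<infinity>. *)
definition slicing_support_fun ::
    "real ^ 'n \<Rightarrow> (real ^ 'n) set \<Rightarrow> real ^ 'n \<Rightarrow> real \<Rightarrow> ereal" where
  "slicing_support_fun \<nu> K u p = (SUP x\<in>{x \<in> K. x \<bullet> \<nu> = p}. ereal (x \<bullet> u))"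

end

theory Submission
  imports Defs
begin

text \<open>Compactness bounds the values \<open>x \<bullet> v\<close> on \<open>K\<close>, so the
  real supremum is a genuine upper bound.\<close>

lemma inner_le_support_fun:
  assumes "convex_body K" "x \<in> K"
  shows "x \<bullet> v \<le> support_fun K v"
proof -
  have "compact ((\<lambda>x. x \<bullet> v) ` K)"
    using assms(1) unfolding convex_body_def
    by (intro compact_continuous_image continuous_intros) auto
  then have "bdd_above ((\<lambda>x. x \<bullet> v) ` K)"
    by (intro bounded_imp_bdd_above compact_imp_bounded)
  then show ?thesis
    unfolding support_fun_def using assms(2) by (intro cSUP_upper)
qed

lemma support_fun_le:
  assumes "convex_body K" "\<And>x. x \<in> K \<Longrightarrow> x \<bullet> v \<le> c"
  shows "support_fun K v \<le> c"
  unfolding support_fun_def using assms by (intro cSUP_least) (auto simp: convex_body_def)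

text \<open>A point of \<open>K\<close> outside \<open>L\<close> could be strictly separated from
  \<open>L\<close>, and the normal of the separating hyperplane would violate the
  inequality.\<close>

lemma subset_if_support_fun_le:
  assumes K: "convex_body K" and L: "convex_body L"
    and le: "\<And>v. support_fun K v \<le> support_fun L v"
  shows "K \<subseteq> L"
proof
  fix x assume "x \<in> K"
  show "x \<in> L"
  proof (rule ccontr)
    assume "x \<notin> L"
    moreover have "convex L" "closed L"
      using L by (auto simp: convex_body_def compact_imp_closed)
    ultimately obtain a b where ab: "a \<bullet> x < b" "\<forall>y\<in>L. b < a \<bullet> y"
      using separating_hyperplane_closed_point by blast
    \<comment> \<open>The separation puts \<open>L\<close> on the upper side of \<open>a\<close>, so
      the direction pointing from \<open>L\<close> towards \<open>x\<close> is
      \<open>- a\<close>.\<close>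
    have "x \<bullet> (- a) \<le> support_fun K (- a)"
      using K \<open>x \<in> K\<close> by (rule inner_le_support_fun)
    also have "\<dots> \<le> support_fun L (- a)"
      by (rule le)
    also have "\<dots> \<le> - b"
      using L by (rule support_fun_le) (use ab(2) in \<open>auto simp: inner_commute intro: less_imp_le\<close>)
    finally show False
      using ab(1) by (simp add: inner_commute)
  qed
qed

text \<open>On the slice at height \<open>p\<close>, the functional given by \<open>v\<close> differs from the one given by the
  projection \<open>u\<close> of \<open>v\<close> to the hyperplane orthogonal to \<open>\<nu>\<close> only by the constant \<open>p * (v \<bullet> \<nu>)\<close>.\<close>

lemma inner_le_support_fun_if_slicing_le:
  assumes L: "convex_body L" and \<nu>: "norm \<nu> = 1" and x: "x \<in> K"
    and le: "\<And>u p. u \<bullet> \<nu> = 0 \<Longrightarrow> slicing_support_fun \<nu> K u p \<le> slicing_support_fun \<nu> L u p"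
  shows "x \<bullet> v \<le> support_fun L v"
\<comment> \<open>Working with an arbitrary \<open>c\<close> below \<open>x \<bullet> v\<close>
  gives a strict inequality, so the supremum over the slice of \<open>L\<close> need not be shown to
  be attained.\<close>
proof (rule dense_le)
  fix c assume c: "c < x \<bullet> v"
  define p where "p = x \<bullet> \<nu>"
  define u where "u = v - (v \<bullet> \<nu>) *\<^sub>R \<nu>"
  have "\<nu> \<bullet> \<nu> = 1"
    using \<nu> by (simp add: dot_square_norm)
  then have u: "u \<bullet> \<nu> = 0"
    by (simp add: u_def inner_diff_left)
  have shift: "y \<bullet> v = y \<bullet> u + (v \<bullet> \<nu>) * (y \<bullet> \<nu>)" for y
    by (simp add: u_def inner_diff_right)
  have "ereal (c - (v \<bullet> \<nu>) * p) < ereal (x \<bullet> u)"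
    using c shift[of x] by (simp add: p_def)
  also have "\<dots> \<le> slicing_support_fun \<nu> K u p"
    unfolding slicing_support_fun_def using x by (intro SUP_upper) (simp add: p_def)
  also have "\<dots> \<le> slicing_support_fun \<nu> L u p"
    using u by (rule le)
  \<comment> \<open>Lying strictly above a real number, the supremum is not the value -\<infinity>
    of an empty slice, and some point of the slice of \<open>L\<close> already exceeds that
    number.\<close>
  finally obtain y where y: "y \<in> L" "y \<bullet> \<nu> = p" "c - (v \<bullet> \<nu>) * p < y \<bullet> u"
    unfolding slicing_support_fun_def less_SUP_iff by auto
  then have "c \<le> y \<bullet> v"
    using shift[of y] by simp
  also have "\<dots> \<le> support_fun L v"
    using L y(1) by (rule inner_le_support_fun)
  finally show "c \<le> support_fun L v" .
qed

theorem corollary2: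
  fixes K L :: "(real ^ 'n) set" and \<nu> :: "real ^ 'n"
  assumes "convex_body K" and "convex_body L"
    and "norm \<nu> = 1"
    and "\<forall>u\<in>{x. x \<bullet> \<nu> = 0}. \<forall>p. slicing_support_fun \<nu> K u p \<le> slicing_support_fun \<nu> L u p"
  shows "(\<forall>v. support_fun K v \<le> support_fun L v) \<and> K \<subseteq> L"
proof -
  have "support_fun K v \<le> support_fun L v" for v
    using assms(1)
    by (rule support_fun_le) (use assms in \<open>auto intro: inner_le_support_fun_if_slicing_le\<close>)
  then show ?thesis
    using subset_if_support_fun_le[OF assms(1,2)] by blast
qed

end
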